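(* Let $X$ be a compact metrizable space. Then $\mathrm{Shad}(X)\cap\mathrm{CPE}(X)$ is a Borel subset of $\mathrm{TDS}(X)$.
   Context: $\mathrm{TDS}(X)$ is the Polish space of all continuous maps $T:X\to X$ with the topology of the sup metric. A topological dynamical system (TDS) is a pair $(X,T)$ with $X$ compact metrizable (with a compatible metric $d$) and $T:X\to X$ continuous. For $\delta>0$, a sequence $\{x_n\}_{n\in\mathbb N}\subseteq X$ is a $\delta$-pseudo orbit if $d(T(x_n),x_{n+1})\le\delta$ for every $n\in\mathbb N$. $(X,T)$ has the shadowing property if for every $\varepsilon>0$ there is $\delta>0$ such that for every $\delta$-pseudo orbit $\{x_n\}_{n\in\mathbb N}$ there is $y\in X$ with $d(x_n,T^n(y))\le\varepsilon$ for all $n\in\mathbb N$. $(X_2,T_2)$ is a factor of $(X_1,T_1)$ if there is a continuous surjection $\phi:X_1\to X_2$ with $\phi\circ T_1=T_2\circ\phi$. $(X,T)$ has completely positive entropy (CPE) if every non-trivial factor (i.e. factor whose space is not a single point) has positive topological entropy. $\mathrm{Shad}(X)$ and $\mathrm{CPE}(X)$ are the sets of $T\in\mathrm{TDS}(X)$ such that $(X,T)$ has the shadowing property, respectively has CPE. *)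

theory Defs
  imports "HOL-Analysis.Analysis"
begin

text \<open>
  The compact metrizable space \<open>X\<close> is a type \<open>'a :: metric_space\<close> with \<open>compact (UNIV :: 'a set)\<close>.
  All continuous self-maps of \<open>X\<close> are then bounded, so \<open>TDS(X)\<close> is the type \<open>'a \<Rightarrow>\<^sub>C 'a\<close>, whose
  library metric is the sup metric. Factors live on other spaces; these are
  represented by abstract topologies, and a self-map of such a space only matters on its carrier.
\<close>

definition tds :: "'b topology \<Rightarrow> ('b \<Rightarrow> 'b) \<Rightarrow> bool" where
  "tds Y S \<longleftrightarrow> compact_space Y \<and> metrizable_space Y \<and> continuous_map Y Y S"

definition factor_of :: "'b topology \<Rightarrow> ('b \<Rightarrow> 'b) \<Rightarrow> 'a topology \<Rightarrow> ('a \<Rightarrow> 'a) \<Rightarrow> bool" where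
  "factor_of Y S X T \<longleftrightarrow>
     (\<exists>\<phi>. continuous_map X Y \<phi> \<and> \<phi> ` topspace X = topspace Y \<and>
          (\<forall>x\<in>topspace X. \<phi> (T x) = S (\<phi> x)))"


subsection \<open>Topological entropy (via open covers)\<close>

definition open_cover :: "'b topology \<Rightarrow> 'b set set \<Rightarrow> bool" where
  "open_cover Y C \<longleftrightarrow> (\<forall>U\<in>C. openin Y U) \<and> \<Union>C = topspace Y"

text \<open>The join of \<open>C\<close> with its preimages under \<open>S, \<dots>, S ^^ (n - 1)\<close>: its members are the sets
  \<open>\<Inter>i<n. (S ^^ i) -` U i\<close> with \<open>U i \<in> C\<close>.\<close>
definition cover_join :: "'b topology \<Rightarrow> ('b \<Rightarrow> 'b) \<Rightarrow> 'b set set \<Rightarrow> nat \<Rightarrow> 'b set set" where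
  "cover_join Y S C n = {{y \<in> topspace Y. \<forall>i<n. (S ^^ i) y \<in> U i} | U. \<forall>i<n. U i \<in> C}"

definition min_subcover :: "'b topology \<Rightarrow> 'b set set \<Rightarrow> nat" where
  "min_subcover Y C = (LEAST k. \<exists>D\<subseteq>C. finite D \<and> card D = k \<and> topspace Y \<subseteq> \<Union>D)"

text \<open>On a compact space the limit exists, by subadditivity of the logarithms (Fekete).\<close>
definition cover_entropy :: "'b topology \<Rightarrow> ('b \<Rightarrow> 'b) \<Rightarrow> 'b set set \<Rightarrow> real" where
  "cover_entropy Y S C = lim (\<lambda>n. ln (real (min_subcover Y (cover_join Y S C n))) / real n)"

definition top_entropy :: "'b topology \<Rightarrow> ('b \<Rightarrow> 'b) \<Rightarrow> ereal" where
  "top_entropy Y S = (SUP C\<in>{C. open_cover Y C}. ereal (cover_entropy Y S C))"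


subsection \<open>Shadowing and completely positive entropy\<close>

definition pseudo_orbit :: "('a::metric_space \<Rightarrow> 'a) \<Rightarrow> real \<Rightarrow> (nat \<Rightarrow> 'a) \<Rightarrow> bool" where
  "pseudo_orbit T \<delta> x \<longleftrightarrow> (\<forall>n. dist (T (x n)) (x (Suc n)) \<le> \<delta>)"

definition shadowing :: "('a::metric_space \<Rightarrow> 'a) \<Rightarrow> bool" where
  "shadowing T \<longleftrightarrow>
     (\<forall>\<epsilon>>0. \<exists>\<delta>>0. \<forall>x. pseudo_orbit T \<delta> x \<longrightarrow> (\<exists>y. \<forall>n. dist (x n) ((T ^^ n) y) \<le> \<epsilon>))"

text \<open>HOL cannot quantify over types inside a formula, so the factors range over spaces whose
  carrier is a subset of \<open>'a\<close>. Since a factor is a surjective image of \<open>X\<close>, every factor is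
  conjugate to one of these; see \<open>cpe_imp_factor_entropy_pos\<close> below for factors of arbitrary type.\<close>
definition cpe :: "'a topology \<Rightarrow> ('a \<Rightarrow> 'a) \<Rightarrow> bool" where
  "cpe X T \<longleftrightarrow>
     (\<forall>(Y :: 'a topology) S.
        tds Y S \<and> factor_of Y S X T \<and> (\<nexists>p. topspace Y = {p}) \<longrightarrow> 0 < top_entropy Y S)"

definition Shad :: "('a::metric_space \<Rightarrow>\<^sub>C 'a) set" where
  "Shad = {T. shadowing (apply_bcontfun T)}"

definition CPE :: "('a::metric_space \<Rightarrow>\<^sub>C 'a) set" where
  "CPE = {T. cpe euclidean (apply_bcontfun T)}"


subsection \<open>Independence of the carrier type of the factor\<close>

lemma top_entropy_factor_le:
  fixes X :: "'a topology" and Y :: "'b topology"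
  assumes T: "T ` topspace X \<subseteq> topspace X" and f: "factor_of Y S X T"
  shows "top_entropy Y S \<le> top_entropy X T"
proof -
  obtain g where cg: "continuous_map X Y g" and gs: "g ` topspace X = topspace Y"
    and eq: "\<And>x. x \<in> topspace X \<Longrightarrow> g (T x) = S (g x)"
    using f by (auto simp: factor_of_def)
  define p where "p U = {x \<in> topspace X. g x \<in> U}" for U
  have Tn: "(T ^^ i) x \<in> topspace X" if "x \<in> topspace X" for i x
    using that T by (induction i) auto
  have it: "g ((T ^^ i) x) = (S ^^ i) (g x)" if "x \<in> topspace X" for i x
    by (induction i) (use that Tn eq in auto)
  have join: "cover_join X T (p ` C) n = p ` cover_join Y S C n" for C n
  proof -
    have *: "{x \<in> topspace X. \<forall>i<n. (T ^^ i) x \<in> p (U i)}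
             = p {y \<in> topspace Y. \<forall>i<n. (S ^^ i) y \<in> U i}" for U
      using gs it Tn by (auto simp: p_def)
    show ?thesis
    proof (intro set_eqI iffI)
      fix A assume "A \<in> cover_join X T (p ` C) n"
      then obtain V where V: "\<forall>i<n. V i \<in> p ` C"
        and A: "A = {x \<in> topspace X. \<forall>i<n. (T ^^ i) x \<in> V i}"
        by (auto simp: cover_join_def)
      from V have "\<forall>i. \<exists>U. i < n \<longrightarrow> U \<in> C \<and> V i = p U" by blast
      then obtain U where U: "\<And>i. i < n \<Longrightarrow> U i \<in> C \<and> V i = p (U i)" by metis
      have "A = p {y \<in> topspace Y. \<forall>i<n. (S ^^ i) y \<in> U i}"
        unfolding A *[symmetric] using U by auto
      moreover have "{y \<in> topspace Y. \<forall>i<n. (S ^^ i) y \<in> U i} \<in> cover_join Y S C n"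
        unfolding cover_join_def using U by (intro CollectI exI[of _ U]) simp
      ultimately show "A \<in> p ` cover_join Y S C n" by (rule image_eqI)
    next
      fix A assume "A \<in> p ` cover_join Y S C n"
      then obtain U where U: "\<forall>i<n. U i \<in> C"
        and A: "A = p {y \<in> topspace Y. \<forall>i<n. (S ^^ i) y \<in> U i}"
        by (auto simp: cover_join_def)
      show "A \<in> cover_join X T (p ` C) n"
        unfolding A *[symmetric] cover_join_def
        using U by (intro CollectI exI[of _ "\<lambda>i. p (U i)"]) auto
    qed
  qed
  have cov: "topspace X \<subseteq> \<Union>(p ` D) \<longleftrightarrow> topspace Y \<subseteq> \<Union>D" for D
    unfolding gs[symmetric] by (auto simp: p_def)
  have N: "min_subcover X (p ` C) = min_subcover Y C" if C: "\<forall>U\<in>C. U \<subseteq> topspace Y" for C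
  proof -
    have inj: "inj_on p C"
    proof (rule inj_onI)
      fix U V assume "U \<in> C" "V \<in> C" "p U = p V"
      moreover have "g ` p W = W" if "W \<in> C" for W
      proof
        show "W \<subseteq> g ` p W"
        proof
          fix w assume "w \<in> W"
          with C that gs obtain x where "x \<in> topspace X" "w = g x" by blast
          with \<open>w \<in> W\<close> show "w \<in> g ` p W" by (auto simp: p_def)
        qed
      qed (auto simp: p_def)
      ultimately show "U = V" by metis
    qed
    have "(\<exists>D\<subseteq>p ` C. finite D \<and> card D = k \<and> topspace X \<subseteq> \<Union>D) \<longleftrightarrow>
          (\<exists>D\<subseteq>C. finite D \<and> card D = k \<and> topspace Y \<subseteq> \<Union>D)" (is "?l \<longleftrightarrow> ?r") for k
    proof
      assume ?l
      then obtain D where D: "D \<subseteq> p ` C" "finite D" "card D = k" "topspace X \<subseteq> \<Union>D" by blast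
      then obtain E where E: "E \<subseteq> C" "D = p ` E" by (meson subset_imageE)
      have iE: "inj_on p E" using inj E(1) by (rule inj_on_subset)
      show ?r using D(2-4) E(1) cov[of E] unfolding E(2)
        by (intro exI[of _ E]) (simp add: card_image[OF iE] finite_image_iff[OF iE])
    next
      assume ?r
      then obtain E where E: "E \<subseteq> C" "finite E" "card E = k" "topspace Y \<subseteq> \<Union>E" by blast
      have iE: "inj_on p E" using inj E(1) by (rule inj_on_subset)
      show ?l using E cov[of E] by (intro exI[of _ "p ` E"]) (simp add: card_image[OF iE] image_mono)
    qed
    then show ?thesis by (simp add: min_subcover_def)
  qed
  have ent: "cover_entropy X T (p ` C) = cover_entropy Y S C" for C
    unfolding cover_entropy_def join by (subst N) (auto simp: cover_join_def)
  have oc: "open_cover X (p ` C)" if "open_cover Y C" for C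
  proof -
    have "openin X (p U)" if "U \<in> C" for U
      unfolding p_def using \<open>open_cover Y C\<close> that cg
      by (auto simp: open_cover_def intro: openin_continuous_map_preimage)
    moreover have "\<Union>(p ` C) = topspace X"
      using cov[of C] that by (auto simp: open_cover_def p_def)
    ultimately show ?thesis by (auto simp: open_cover_def)
  qed
  show ?thesis
    unfolding top_entropy_def
  proof (rule SUP_least)
    fix C assume "C \<in> {C. open_cover Y C}"
    then have "p ` C \<in> {C. open_cover X C}" using oc by simp
    then have "ereal (cover_entropy X T (p ` C)) \<le> (SUP C\<in>{C. open_cover X C}. ereal (cover_entropy X T C))"
      by (rule SUP_upper)
    then show "ereal (cover_entropy Y S C) \<le> (SUP C\<in>{C. open_cover X C}. ereal (cover_entropy X T C))"
      by (simp only: ent)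
  qed
qed

lemma cpe_imp_factor_entropy_pos:
  fixes X :: "'a topology" and Y :: "'b topology"
  assumes cpe: "cpe X T" and Y: "tds Y S" and f: "factor_of Y S X T"
    and nontriv: "\<nexists>q. topspace Y = {q}"
  shows "0 < top_entropy Y S"
proof -
  obtain g where cg: "continuous_map X Y g" and gs: "g ` topspace X = topspace Y"
    and eq: "\<And>x. x \<in> topspace X \<Longrightarrow> g (T x) = S (g x)"
    using f by (auto simp: factor_of_def)
  define s where "s = inv_into (topspace X) g"
  define A where "A = s ` topspace Y"
  define Z where "Z = pullback_topology A g Y"
  define R where "R = s \<circ> S \<circ> g"
  have SY: "S y \<in> topspace Y" if "y \<in> topspace Y" for y
    using Y that by (auto simp: tds_def continuous_map_def)
  have gsy: "g (s y) = y" if "y \<in> topspace Y" for y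
    using that gs unfolding s_def by (simp add: f_inv_into_f)
  have tZ: "topspace Z = A"
    by (auto simp: Z_def topspace_pullback_topology A_def gsy)
  have cgZ: "continuous_map Z Y g"
    using continuous_map_pullback[of Y Y id A g] by (simp add: Z_def)
  have csZ: "continuous_map Y Z s"
    unfolding Z_def
  proof (rule continuous_map_pullback')
    show "continuous_map Y Y (g \<circ> s)"
      by (rule continuous_map_eq[of _ _ id]) (auto simp: gsy)
    show "topspace Y \<subseteq> s -` A" by (auto simp: A_def)
  qed
  have hm: "homeomorphic_maps Y Z s g"
    using cgZ csZ by (auto simp: homeomorphic_maps_def tZ A_def gsy)
  then have hs: "Y homeomorphic_space Z" by (rule homeomorphic_maps_imp_homeomorphic_space)
  have "tds Z R"
    using Y homeomorphic_compact_space[OF hs] homeomorphic_metrizable_space[OF hs] cgZ csZ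
    unfolding tds_def R_def by (auto intro!: continuous_map_compose)
  moreover have "factor_of Z R X T"
    unfolding factor_of_def
  proof (intro exI[of _ "s \<circ> g"] conjI ballI)
    show "continuous_map X Z (s \<circ> g)" using cg csZ by (rule continuous_map_compose)
    show "(s \<circ> g) ` topspace X = topspace Z" by (simp only: tZ A_def image_comp[symmetric] gs)
    fix x assume "x \<in> topspace X"
    moreover from this have "g x \<in> topspace Y" using gs by blast
    ultimately show "(s \<circ> g) (T x) = R ((s \<circ> g) x)"
      by (simp add: R_def eq gsy)
  qed
  moreover have "\<nexists>q. topspace Z = {q}"
  proof
    assume "\<exists>q. topspace Z = {q}"
    then obtain q where "s ` topspace Y = {q}" by (auto simp: tZ A_def)
    then have "g ` s ` topspace Y = {g q}" by simp
    moreover have "g ` s ` topspace Y = topspace Y" by (force simp: gsy)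
    ultimately show False using nontriv by auto
  qed
  ultimately have "0 < top_entropy Z R" using cpe by (auto simp: cpe_def)
  also have "\<dots> \<le> top_entropy Y S"
  proof (rule top_entropy_factor_le)
    show "S ` topspace Y \<subseteq> topspace Y" using SY by auto
    show "factor_of Z R Y S"
      unfolding factor_of_def using csZ by (intro exI[of _ s]) (auto simp: tZ A_def R_def gsy)
  qed
  finally show ?thesis .
qed

end

theory Submission
  imports Defs
begin

text \<open>
  Shadowing turns completely positive entropy into a combinatorial condition on chains. Fix a
  countable dense set \<open>D\<close>. For a map \<open>T\<close> with the shadowing property, \<open>T\<close> has completely positive
  entropy if and only if for all \<open>p\<close> and \<open>q\<close> in \<open>D\<close> and all \<open>e > 0\<close> there are \<open>e\<close>-chains of the same
  positive length from \<open>p\<close> to \<open>p\<close> and from \<open>p\<close> to \<open>q\<close>. The existence of a chain between two given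
  points is an open condition on \<open>T\<close>, so this condition is Borel; and shadowing itself
  is Borel because it can be tested on finite pseudo orbits in \<open>D\<close>
  (\<open>shadowing_iff_finite\<close>), again by conditions that are open in \<open>T\<close> for each such pseudo orbit.

  The chain condition follows from completely positive entropy alone, by exhibiting a nontrivial
  factor of zero entropy whenever it fails. If chains from \<open>p\<close> do not reach \<open>q\<close>, the passage of
  orbits into the reachable set gives a factor that is a monotone map on a set of reals
  (\<open>cpe_chain_transitive\<close>). If they reach everything, but some points never by chains of the same
  length, then reachability from \<open>p\<close> by chains of a common length is an open
  invariant equivalence relation and gives a finite factor (\<open>cpe_chain_synchronized\<close>).

  Conversely, the chain condition yields two loops of equal length at \<open>p\<close> which are at \<open>p\<close> and at
  \<open>q\<close> at a common time. Shadowing realises all concatenations of these loops by orbits, a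
  horseshoe with positive entropy in every factor that separates \<open>p\<close> from \<open>q\<close>
  (\<open>shadowing_synchronized_imp_cpe\<close>).
\<close>

section \<open>Subadditive sequences\<close>

lemma subadditive_mult_le:
  fixes a :: "nat \<Rightarrow> real"
  assumes sub: "\<And>m n. a (m + n) \<le> a m + a n" and "a 0 = 0"
  shows "a (q * m) \<le> real q * a m"
proof (induction q)
  case (Suc q)
  then show ?case using sub[of m "q * m"] by (simp add: algebra_simps)
qed (simp add: assms)

text \<open>
  Fekete's lemma. It is what makes the \<open>lim\<close> in the entropy of a cover a genuine limit, so that a
  lower bound along a subsequence is a lower bound for the entropy.
\<close>
lemma subadditive_convergent:
  fixes a :: "nat \<Rightarrow> real"
  assumes sub: "\<And>m n. a (m + n) \<le> a m + a n" and pos: "\<And>n. 0 \<le> a n" and z: "a 0 = 0"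
  shows "convergent (\<lambda>n. a n / real n)"
proof -
  define L where "L = (INF n\<in>{1..}. a n / real n)"
  have bdd: "bdd_below ((\<lambda>n. a n / real n) ` {1..})"
    by (rule bdd_belowI[of _ 0]) (auto simp: pos)
  have lower: "L \<le> a n / real n" if "n \<ge> 1" for n
    unfolding L_def by (rule cINF_lower[OF bdd]) (use that in auto)
  have "(\<lambda>n. a n / real n) \<longlonglongrightarrow> L"
  proof (rule LIMSEQ_I)
    fix e :: real assume "e > 0"
    then obtain m where m: "m \<ge> 1" "a m / real m < L + e / 2"
      using cINF_less_iff[of "{1::nat..}" "\<lambda>n. a n / real n" "L + e / 2"] bdd
      by (auto simp: L_def)
    \<comment> \<open>For \<open>n = q m + r\<close> with \<open>r < m\<close>, the remainder costs at most a constant, which vanishes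
      after division by \<open>n\<close>.\<close>
    define M where "M = (\<Sum>r<m. a r)"
    have M: "a r \<le> M" if "r < m" for r
      unfolding M_def using that by (intro member_le_sum) (auto simp: pos)
    obtain N :: nat where N: "2 * M / e < real N" using reals_Archimedean2 by blast
    show "\<exists>no. \<forall>n\<ge>no. norm (a n / real n - L) < e"
    proof (intro exI allI impI)
      fix n assume n: "n \<ge> max 1 N"
      have "a n \<le> real (n div m) * a m + a (n mod m)"
        using sub[of "(n div m) * m" "n mod m"] subadditive_mult_le[of a "n div m" m] sub z
        by simp
      also have "\<dots> \<le> (real n / real m) * a m + M"
        using m M[of "n mod m"] pos[of m] of_nat_div_le_of_nat[of n m]
        by (intro add_mono mult_right_mono) auto
      finally have "a n / real n \<le> a m / real m + M / real n"
        using n m by (simp add: field_simps)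
      moreover have "M / real n < e / 2"
      proof -
        have "2 * M / e < real n" using N n by linarith
        then show ?thesis using n \<open>e > 0\<close> by (simp add: field_simps)
      qed
      ultimately have "a n / real n < L + e" using m by linarith
      moreover have "L \<le> a n / real n" using lower n by simp
      ultimately show "norm (a n / real n - L) < e" by simp
    qed
  qed
  then show ?thesis by (rule convergentI)
qed

section \<open>Entropy of a cover\<close>

lemma min_subcover_le:
  assumes "D \<subseteq> C" "finite D" "topspace Y \<subseteq> \<Union>D"
  shows "min_subcover Y C \<le> card D"
  unfolding min_subcover_def by (rule Least_le) (use assms in blast)

lemma min_subcover_attained:
  assumes "D \<subseteq> C" "finite D" "topspace Y \<subseteq> \<Union>D"
  obtains E where "E \<subseteq> C" "finite E" "card E = min_subcover Y C" "topspace Y \<subseteq> \<Union>E"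
proof -
  have "\<exists>E\<subseteq>C. finite E \<and> card E = min_subcover Y C \<and> topspace Y \<subseteq> \<Union>E"
    unfolding min_subcover_def by (rule LeastI_ex) (use assms in blast)
  then show ?thesis using that by blast
qed

lemma funpow_in_carrier:
  assumes "S ` A \<subseteq> A" "y \<in> A" shows "(S ^^ i) y \<in> A"
  using assms by (induction i) auto

lemma cover_join_0: "cover_join Y S C 0 = {topspace Y}"
  by (simp add: cover_join_def)

lemma cover_join_add:
  assumes S: "S ` topspace Y \<subseteq> topspace Y"
    and A: "A \<in> cover_join Y S C m" and B: "B \<in> cover_join Y S C n"
  shows "{y \<in> A. (S ^^ m) y \<in> B} \<in> cover_join Y S C (m + n)"
proof -
  obtain U where U: "\<forall>i<m. U i \<in> C" "A = {y \<in> topspace Y. \<forall>i<m. (S ^^ i) y \<in> U i}"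
    using A by (auto simp: cover_join_def)
  obtain V where V: "\<forall>i<n. V i \<in> C" "B = {y \<in> topspace Y. \<forall>i<n. (S ^^ i) y \<in> V i}"
    using B by (auto simp: cover_join_def)
  define W where "W i = (if i < m then U i else V (i - m))" for i
  have "(\<forall>i<m + n. (S ^^ i) y \<in> W i) \<longleftrightarrow>
      (\<forall>i<m. (S ^^ i) y \<in> U i) \<and> (\<forall>i<n. (S ^^ i) ((S ^^ m) y) \<in> V i)" (is "?l \<longleftrightarrow> ?r") for y
  proof
    assume l: ?l
    have "(S ^^ i) ((S ^^ m) y) \<in> V i" if "i < n" for i
      using l[rule_format, of "m + i"] that
      by (simp add: W_def funpow_add[of i m S, unfolded o_def, THEN fun_cong, symmetric] add.commute)
    moreover have "(S ^^ i) y \<in> U i" if "i < m" for i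
      using l[rule_format, of i] that by (simp add: W_def)
    ultimately show ?r by blast
  next
    assume r: ?r
    have "(S ^^ i) y \<in> V (i - m)" if "i < m + n" "\<not> i < m" for i
      using r[THEN conjunct2, rule_format, of "i - m"] that
      by (simp flip: funpow_add[unfolded o_def, THEN fun_cong])
    then show ?l using r by (auto simp: W_def)
  qed
  then have "{y \<in> A. (S ^^ m) y \<in> B} = {y \<in> topspace Y. \<forall>i<m + n. (S ^^ i) y \<in> W i}"
    using funpow_in_carrier[OF S] by (auto simp: U V)
  moreover have "\<forall>i<m + n. W i \<in> C" using U V by (auto simp: W_def)
  ultimately show ?thesis unfolding cover_join_def by blast
qed

text \<open>
  Submultiplicativity of the minimal cardinalities: refine a subcover of the first \<open>m\<close> steps by the
  preimage under \<open>S ^^ m\<close> of a subcover of the next \<open>n\<close> steps.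
\<close>
lemma join_subcover:
  assumes S: "S ` topspace Y \<subseteq> topspace Y"
    and D: "D \<subseteq> cover_join Y S C m" "finite D" "topspace Y \<subseteq> \<Union>D"
    and E: "E \<subseteq> cover_join Y S C n" "finite E" "topspace Y \<subseteq> \<Union>E"
  obtains F where "F \<subseteq> cover_join Y S C (m + n)" "finite F" "topspace Y \<subseteq> \<Union>F"
    "card F \<le> card D * card E"
proof
  define F where "F = (\<lambda>(A, B). {y \<in> A. (S ^^ m) y \<in> B}) ` (D \<times> E)"
  show "F \<subseteq> cover_join Y S C (m + n)"
    using D E by (auto simp: F_def intro!: cover_join_add[OF S])
  show "finite F" using D E by (simp add: F_def)
  show "card F \<le> card D * card E"
    unfolding F_def using card_image_le[of "D \<times> E"] D E by (simp add: card_cartesian_product)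
  show "topspace Y \<subseteq> \<Union>F"
  proof
    fix y assume "y \<in> topspace Y"
    then have "y \<in> \<Union>D" using D(3) by (rule subsetD[rotated])
    moreover have "(S ^^ m) y \<in> \<Union>E"
      by (rule subsetD[OF E(3) funpow_in_carrier[OF S \<open>y \<in> topspace Y\<close>]])
    ultimately show "y \<in> \<Union>F" by (auto simp: F_def)
  qed
qed

lemma finite_subcover_join:
  assumes S: "S ` topspace Y \<subseteq> topspace Y" and Y: "compact_space Y" and C: "open_cover Y C"
  obtains D where "D \<subseteq> cover_join Y S C n" "finite D" "topspace Y \<subseteq> \<Union>D"
proof -
  have "\<exists>D. D \<subseteq> cover_join Y S C n \<and> finite D \<and> topspace Y \<subseteq> \<Union>D"
  proof (induction n)
    case 0
    show ?case by (rule exI[of _ "{topspace Y}"]) (simp add: cover_join_0)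
  next
    case (Suc n)
    then obtain D where D: "D \<subseteq> cover_join Y S C n" "finite D" "topspace Y \<subseteq> \<Union>D" by blast
    obtain E where E: "finite E" "E \<subseteq> C" "topspace Y \<subseteq> \<Union>E"
      using Y C unfolding compact_space_alt open_cover_def by (metis subset_refl)
    have "C \<subseteq> cover_join Y S C 1"
    proof
      fix U assume "U \<in> C"
      moreover have "U \<subseteq> topspace Y" using \<open>U \<in> C\<close> C by (auto simp: open_cover_def)
      ultimately show "U \<in> cover_join Y S C 1"
        unfolding cover_join_def by (intro CollectI exI[of _ "\<lambda>_. U"]) auto
    qed
    with E have "E \<subseteq> cover_join Y S C 1" by blast
    from join_subcover[OF S D this E(1,3)] show ?case by (metis Suc_eq_plus1)
  qed
  then show ?thesis using that by blast
qed

lemma cover_entropy_LIMSEQ: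
  assumes S: "S ` topspace Y \<subseteq> topspace Y" and Y: "compact_space Y" and C: "open_cover Y C"
    and ne: "topspace Y \<noteq> {}"
  shows "(\<lambda>n. ln (real (min_subcover Y (cover_join Y S C n))) / real n) \<longlonglongrightarrow> cover_entropy Y S C"
proof -
  define N where "N n = min_subcover Y (cover_join Y S C n)" for n
  have att: "\<exists>E\<subseteq>cover_join Y S C n. finite E \<and> card E = N n \<and> topspace Y \<subseteq> \<Union>E" for n
    using finite_subcover_join[OF S Y C, of n] min_subcover_attained unfolding N_def by metis
  have pos: "N n \<ge> 1" for n
  proof -
    obtain E where "finite E" "card E = N n" "topspace Y \<subseteq> \<Union>E" using att by blast
    moreover from this have "E \<noteq> {}" using ne by auto
    ultimately show ?thesis by (metis One_nat_def Suc_leI card_gt_0_iff)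
  qed
  have sub: "N (m + n) \<le> N m * N n" for m n
  proof -
    obtain D where D: "D\<subseteq>cover_join Y S C m" "finite D" "topspace Y \<subseteq> \<Union>D" "card D = N m"
      using att by metis
    obtain E where E: "E\<subseteq>cover_join Y S C n" "finite E" "topspace Y \<subseteq> \<Union>E" "card E = N n"
      using att by metis
    obtain F where "F \<subseteq> cover_join Y S C (m + n)" "finite F" "topspace Y \<subseteq> \<Union>F"
      "card F \<le> card D * card E"
      using join_subcover[OF S D(1-3) E(1-3)] .
    then show ?thesis using min_subcover_le[of F _ Y] D E unfolding N_def by (metis le_trans)
  qed
  have "N 0 \<le> card {topspace Y}"
    unfolding N_def cover_join_0 by (rule min_subcover_le) auto
  then have "N 0 = 1" using pos[of 0] by simp
  have "convergent (\<lambda>n. ln (real (N n)) / real n)"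
  proof (rule subadditive_convergent)
    fix m n
    have "ln (real (N (m + n))) \<le> ln (real (N m * N n))"
      using sub[of m n] pos[of "m + n"] by (intro ln_mono) (auto simp del: of_nat_mult)
    also have "\<dots> = ln (real (N m)) + ln (real (N n))"
      using pos[of m] pos[of n] by (simp add: ln_mult)
    finally show "ln (real (N (m + n))) \<le> ln (real (N m)) + ln (real (N n))" .
  qed (use pos \<open>N 0 = 1\<close> in auto)
  then show ?thesis
    unfolding cover_entropy_def N_def by (simp add: convergent_LIMSEQ_iff)
qed

text \<open>
  Exponential growth need only be seen at multiples of a fixed time \<open>N\<close>, which is how long a code
  symbol takes in the horseshoe built below.
\<close>
lemma top_entropy_posI:
  assumes S: "S ` topspace Y \<subseteq> topspace Y" and Y: "compact_space Y" and C: "open_cover Y C"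
    and ne: "topspace Y \<noteq> {}" and "N > 0"
    and ge: "\<And>k E. E \<subseteq> cover_join Y S C (k * N) \<Longrightarrow> finite E \<Longrightarrow> topspace Y \<subseteq> \<Union>E \<Longrightarrow> 2 ^ k \<le> card E"
  shows "0 < top_entropy Y S"
proof -
  let ?a = "\<lambda>n. ln (real (min_subcover Y (cover_join Y S C n))) / real n"
  have "?a \<longlonglongrightarrow> cover_entropy Y S C" by (rule cover_entropy_LIMSEQ[OF S Y C ne])
  moreover have "strict_mono (\<lambda>k. k * N)" using \<open>N > 0\<close> by (simp add: strict_mono_def)
  ultimately have lim: "(\<lambda>k. ?a (k * N)) \<longlonglongrightarrow> cover_entropy Y S C"
    using LIMSEQ_subseq_LIMSEQ unfolding o_def by fastforce
  have "ln 2 / real N \<le> ?a (k * N)" if "k \<ge> 1" for k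
  proof -
    obtain D where "D \<subseteq> cover_join Y S C (k * N)" "finite D" "topspace Y \<subseteq> \<Union>D"
      using finite_subcover_join[OF S Y C] by metis
    then obtain E where E: "E \<subseteq> cover_join Y S C (k * N)" "finite E" "topspace Y \<subseteq> \<Union>E"
      "card E = min_subcover Y (cover_join Y S C (k * N))"
      using min_subcover_attained by metis
    have "real k * ln 2 = ln (real (2 ^ k))" by (simp add: ln_realpow)
    also have "\<dots> \<le> ln (real (card E))"
      using ge[OF E(1-3)] by (intro ln_mono) (simp_all only: of_nat_le_iff, simp_all)
    finally show ?thesis using that \<open>N > 0\<close> E(4) by (simp add: field_simps)
  qed
  then have "ln 2 / real N \<le> cover_entropy Y S C"
    by (intro LIMSEQ_le_const[OF lim]) blast
  moreover have "0 < ln 2 / real N" using \<open>N > 0\<close> by simp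
  ultimately have "0 < ereal (cover_entropy Y S C)" by simp
  also have "\<dots> \<le> top_entropy Y S"
    unfolding top_entropy_def by (rule SUP_upper) (use C in simp)
  finally show ?thesis .
qed

text \<open>
  Labels of the points such that equally labelled points stay in a common member of the cover for
  \<open>n\<close> steps yield a subcover with one member for each label. With only linearly many labels
  the logarithm grows too slowly for positive entropy.
\<close>
lemma cover_entropy_eq_0I:
  assumes "\<And>n. \<exists>g :: _ \<Rightarrow> nat. (\<forall>y\<in>topspace Y. g y \<le> K * n + K) \<and>
     (\<forall>x\<in>topspace Y. \<forall>i<n. \<exists>U\<in>C. \<forall>y\<in>topspace Y. g y = g x \<longrightarrow> (S ^^ i) y \<in> U)"
  shows "cover_entropy Y S C = 0"
proof -
  define N where "N n = min_subcover Y (cover_join Y S C n)" for n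
  have le: "N n \<le> K * n + K + 1" for n
  proof -
    obtain g :: "_ \<Rightarrow> nat" where g: "\<And>y. y\<in>topspace Y \<Longrightarrow> g y \<le> K * n + K" and
     "\<forall>x\<in>topspace Y. \<forall>i<n. \<exists>U\<in>C. \<forall>y\<in>topspace Y. g y = g x \<longrightarrow> (S ^^ i) y \<in> U"
      using assms[of n] by blast
    then have "\<exists>U. l \<in> g ` topspace Y \<and> i < n \<longrightarrow>
        U \<in> C \<and> (\<forall>y\<in>topspace Y. g y = l \<longrightarrow> (S ^^ i) y \<in> U)" for l i
      by fastforce
    then obtain U where U: "\<And>l i. l \<in> g ` topspace Y \<and> i < n \<longrightarrow>
        U l i \<in> C \<and> (\<forall>y\<in>topspace Y. g y = l \<longrightarrow> (S ^^ i) y \<in> U l i)"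
      by metis
    define E where "E = (\<lambda>l. {y\<in>topspace Y. \<forall>i<n. (S ^^ i) y \<in> U l i}) ` g ` topspace Y"
    have sub: "g ` topspace Y \<subseteq> {..K * n + K}" using g by auto
    then have fin: "finite (g ` topspace Y)" by (rule finite_subset) simp
    have "N n \<le> card E"
      unfolding N_def
    proof (rule min_subcover_le)
      show "E \<subseteq> cover_join Y S C n" using U unfolding E_def cover_join_def by blast
      show "finite E" using fin by (simp add: E_def)
      show "topspace Y \<subseteq> \<Union>E" using U by (auto simp: E_def)
    qed
    also have "\<dots> \<le> card (g ` topspace Y)" unfolding E_def by (rule card_image_le[OF fin])
    also have "\<dots> \<le> card {..K * n + K}" by (rule card_mono) (use sub in auto)
    finally show ?thesis by simp
  qed
  have "(\<lambda>n. ln (real (N n)) / real n) \<longlonglongrightarrow> 0"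
  proof (rule tendsto_sandwich)
    show "\<forall>\<^sub>F n in sequentially. 0 \<le> ln (real (N n)) / real n"
      by (rule always_eventually) (metis divide_nonneg_nonneg ln_ge_zero ln_0 of_nat_0 of_nat_0_le_iff
          One_nat_def Suc_leI gr0I of_nat_1 of_nat_le_iff order_refl)
    show "\<forall>\<^sub>F n in sequentially. ln (real (N n)) / real n \<le>
        ln (2 * real K + 1) * (1 / real n) + ln (real n) / real n"
    proof (rule eventually_sequentiallyI[of 1])
      fix n :: nat assume n: "1 \<le> n"
      have "K \<le> K * n" using n by simp
      then have "N n \<le> K * n + K * n + n" using le[of n] n by linarith
      then have "N n \<le> (2 * K + 1) * n" by (simp add: algebra_simps)
      then have b: "real (N n) \<le> (2 * real K + 1) * real n"
        by (metis (no_types, lifting) of_nat_1 of_nat_add of_nat_le_iff of_nat_mult of_nat_numeral)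
      have "ln (real (N n)) \<le> ln ((2 * real K + 1) * real n)"
      proof (cases "N n = 0")
        case True
        have "1 * 1 \<le> (2 * real K + 1) * real n" using n by (intro mult_mono) auto
        then show ?thesis using True by (simp add: ln_ge_zero)
      next
        case False then show ?thesis using b by (intro ln_mono) auto
      qed
      also have "\<dots> = ln (2 * real K + 1) + ln (real n)" using n by (simp add: ln_mult)
      finally show "ln (real (N n)) / real n \<le>
        ln (2 * real K + 1) * (1 / real n) + ln (real n) / real n"
        using n by (simp add: field_simps)
    qed
    have "(\<lambda>n. ln (2 * real K + 1) * (1 / real n) + ln (real n) / real n)
        \<longlonglongrightarrow> ln (2 * real K + 1) * 0 + 0"
      by (intro tendsto_intros lim_1_over_n lim_ln_over_n)
    then show "(\<lambda>n. ln (2 * real K + 1) * (1 / real n) + ln (real n) / real n) \<longlonglongrightarrow> 0"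
      by simp
  qed simp
  then show ?thesis unfolding cover_entropy_def N_def by (rule limI)
qed

lemma top_entropy_finite:
  assumes fin: "finite (topspace Y)" and S: "S ` topspace Y \<subseteq> topspace Y"
  shows "top_entropy Y S \<le> 0"
  unfolding top_entropy_def
proof (rule SUP_least)
  fix C assume "C \<in> {C. open_cover Y C}"
  then have C: "\<Union>C = topspace Y" by (simp add: open_cover_def)
  obtain g :: "'a \<Rightarrow> nat" where g: "inj_on g (topspace Y)"
    using finite_imp_inj_to_nat_seg[OF fin] by blast
  define K where "K = Max (insert 0 (g ` topspace Y))"
  have gK: "g y \<le> K" if "y \<in> topspace Y" for y
    unfolding K_def using that fin by (intro Max_ge) auto
  have "cover_entropy Y S C = 0"
  proof (rule cover_entropy_eq_0I, intro exI[of _ g] conjI ballI allI impI)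
    fix n y assume "y \<in> topspace Y" then show "g y \<le> K * n + K" using gK[of y] by simp
  next
    fix x i assume x: "x \<in> topspace Y"
    have "(S ^^ i) x \<in> \<Union>C" unfolding C by (rule funpow_in_carrier[OF S x])
    then obtain U where "U \<in> C" "(S ^^ i) x \<in> U" by blast
    moreover have "y = x" if "y \<in> topspace Y" "g y = g x" for y
      using inj_onD[OF g] that x by blast
    ultimately show "\<exists>U\<in>C. \<forall>y\<in>topspace Y. g y = g x \<longrightarrow> (S ^^ i) y \<in> U" by metis
  qed
  then show "ereal (cover_entropy Y S C) \<le> 0" by simp
qed

text \<open>
  Order keeps orbits from spreading over many itineraries. Cut the line into cells shorter than a Lebesgue number
  of the cover. As \<open>S\<close> is monotone, the itineraries of length \<open>n\<close> of two points through the
  cells are comparable in every coordinate, so the sum of the cell indices already determines the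
  itinerary; this sum takes only linearly many values.
\<close>
lemma top_entropy_mono_on:
  fixes Y :: "real set"
  assumes Y: "compact Y" and mono: "mono_on Y S" and S: "S ` Y \<subseteq> Y"
  shows "top_entropy (top_of_set Y) S \<le> 0"
  unfolding top_entropy_def
proof (rule SUP_least)
  fix C assume "C \<in> {C. open_cover (top_of_set Y) C}"
  then have C: "\<Union>C = Y" and opn: "\<And>U. U \<in> C \<Longrightarrow> openin (top_of_set Y) U"
    by (auto simp: open_cover_def)
  obtain a b where ab: "Y \<subseteq> {a..b}"
    using compact_imp_bounded[OF Y] bounded_subset_cbox_symmetric[of Y] by (metis box_real(2))
  have "Y \<subseteq> \<Union>{V. open V \<and> Y \<inter> V \<in> C}"
  proof
    fix y assume "y \<in> Y"
    then obtain U where "y \<in> U" "U \<in> C" using C by blast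
    with opn[of U] show "y \<in> \<Union>{V. open V \<and> Y \<inter> V \<in> C}" by (auto simp: openin_open)
  qed
  from Heine_Borel_lemma[OF Y this] obtain r where r: "r > 0"
    "\<And>x. x \<in> Y \<Longrightarrow> \<exists>V\<in>{V. open V \<and> Y \<inter> V \<in> C}. ball x r \<subseteq> V" by blast
  \<comment> \<open>The index of the cell of length \<open>r\<close> that contains \<open>v\<close>.\<close>
  define l where "l v = nat \<lfloor>(v - a) / r\<rfloor>" for v
  define K where "K = l b"
  have l_mono: "l v \<le> l w" if "v \<le> w" for v w
    unfolding l_def using that r(1) by (intro nat_mono floor_mono divide_right_mono) auto
  have Sn: "(S ^^ i) v \<in> Y" if "v \<in> Y" for v i
    using funpow_in_carrier[OF S that] .
  have S_mono: "(S ^^ i) v \<le> (S ^^ i) w" if "v \<in> Y" "w \<in> Y" "v \<le> w" for v w i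
  proof (induction i)
    case (Suc i)
    then show ?case using mono_onD[OF mono Sn[OF that(1)] Sn[OF that(2)]] by simp
  qed (use that in simp)
  have close: "\<bar>v - w\<bar> < r" if "v \<in> Y" "w \<in> Y" "l v = l w" for v w
  proof -
    have "v \<ge> a" "w \<ge> a" using ab that by auto
    then have "\<lfloor>(v - a) / r\<rfloor> = \<lfloor>(w - a) / r\<rfloor>"
      using that(3) r(1) unfolding l_def by (simp add: eq_nat_nat_iff)
    then have "\<bar>(v - a) / r - (w - a) / r\<bar> < 1" by linarith
    then show ?thesis using r(1) by (simp add: diff_divide_distrib[symmetric] abs_divide)
  qed
  have "cover_entropy (top_of_set Y) S C = 0"
  proof (rule cover_entropy_eq_0I)
    fix n
    define g where "g v = (\<Sum>i<n. l ((S ^^ i) v))" for v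
    have "g y \<le> K * n + K" if "y \<in> Y" for y
    proof -
      have "g y \<le> (\<Sum>i<n. K)"
        unfolding g_def K_def using subsetD[OF ab Sn[OF that]] by (intro sum_mono l_mono) auto
      then show ?thesis by (simp add: mult.commute)
    qed
    moreover have "\<exists>U\<in>C. \<forall>y\<in>Y. g y = g x \<longrightarrow> (S ^^ i) y \<in> U" if x: "x \<in> Y" and i: "i < n" for x i
    proof -
      obtain V where V: "Y \<inter> V \<in> C" "ball ((S ^^ i) x) r \<subseteq> V" using r(2)[OF Sn[OF x]] by blast
      have eq: "l ((S ^^ i) v) = l ((S ^^ i) w)"
        if "v \<in> Y" "w \<in> Y" "v \<le> w" "g v = g w" for v w
        using that(4) unfolding g_def
        by (rule sum_mono_inv) (use S_mono[OF that(1-3)] l_mono i in auto)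
      have "(S ^^ i) y \<in> Y \<inter> V" if "y \<in> Y" "g y = g x" for y
      proof -
        have "l ((S ^^ i) y) = l ((S ^^ i) x)"
          using eq[of x y] eq[of y x] that x by (metis linear)
        then have "(S ^^ i) y \<in> ball ((S ^^ i) x) r"
          using close[OF Sn[OF x, of i] Sn[OF that(1), of i]] by (simp add: dist_real_def)
        then show ?thesis using V(2) Sn[OF that(1)] by blast
      qed
      then show ?thesis using V(1) by blast
    qed
    ultimately show "\<exists>g :: _ \<Rightarrow> nat. (\<forall>y\<in>topspace (top_of_set Y). g y \<le> K * n + K) \<and>
      (\<forall>x\<in>topspace (top_of_set Y). \<forall>i<n. \<exists>U\<in>C. \<forall>y\<in>topspace (top_of_set Y). g y = g x \<longrightarrow> (S ^^ i) y \<in> U)"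
      by (intro exI[of _ g]) simp
  qed
  then show "ereal (cover_entropy (top_of_set Y) S C) \<le> 0" by simp
qed

section \<open>Chains\<close>

text \<open>
  An \<open>e\<close>-chain of length \<open>n\<close> from \<open>x\<close> to \<open>y\<close>, that is a finite pseudo orbit, is a pair in
  \<open>jump T e ^^ n\<close>. The inequality is strict so that having such a chain is an open condition on
  \<open>y\<close> and on \<open>T\<close>.
\<close>
definition jump :: "('a::metric_space \<Rightarrow> 'a) \<Rightarrow> real \<Rightarrow> 'a rel" where
  "jump T e = {(x, y). dist (T x) y < e}"

lemma chain_Suc_iff: "(x, y) \<in> jump T e ^^ Suc n \<longleftrightarrow> (\<exists>z. (x, z) \<in> jump T e ^^ n \<and> dist (T z) y < e)"
  by (auto simp: jump_def)

lemma chain_trans: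
  "(x, y) \<in> jump T e ^^ m \<Longrightarrow> (y, z) \<in> jump T e ^^ n \<Longrightarrow> (x, z) \<in> jump T e ^^ (m + n)"
  by (auto simp: relpow_add)

lemma chain_step: "e > 0 \<Longrightarrow> (x, y) \<in> jump T e ^^ n \<Longrightarrow> (x, T y) \<in> jump T e ^^ Suc n"
  by (auto simp: jump_def)

lemma chain_mono: "d \<le> e \<Longrightarrow> (x, y) \<in> jump T d ^^ n \<Longrightarrow> (x, y) \<in> jump T e ^^ n"
  by (force simp: relpow_fun_conv jump_def)

lemma open_chain_reach: "open {y. (x, y) \<in> jump T e ^^ Suc n}"
proof -
  have "{y. (x, y) \<in> jump T e ^^ Suc n} = (\<Union>z\<in>{z. (x, z) \<in> jump T e ^^ n}. ball (T z) e)"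
    by (auto simp: jump_def)
  then show ?thesis by (simp only:) (intro open_UN ballI open_ball)
qed

section \<open>Chains under completely positive entropy\<close>

text \<open>
  Let \<open>U\<close> be the set of points that chains from \<open>p\<close> reach, and suppose that \<open>q\<close> lies outside. The
  map pushes \<open>U\<close> strictly into itself: the \<open>e\<close>-neighbourhood of \<open>T ` U\<close> is in \<open>U\<close>. Hence there is
  a continuous \<open>h\<close> that is \<open>0\<close> on \<open>T ` U\<close> and \<open>1\<close> off \<open>U\<close>, and along every orbit \<open>h\<close> reads
  \<open>1, \<dots>, 1, t, 0, 0, \<dots>\<close> with at most one intermediate value \<open>t\<close>. Read these sequences as binary
  expansions: this is a semiconjugacy \<open>\<pi>\<close> to the monotone map
  \<open>v \<mapsto> max 0 (2 * v - 1)\<close> on a set of reals, a nontrivial factor of zero entropy.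
\<close>
lemma cpe_chain_transitive:
  fixes T :: "'a::metric_space \<Rightarrow> 'a"
  assumes X: "compact (UNIV :: 'a set)" and T: "continuous_on UNIV T"
    and cpe: "cpe euclidean T" and e: "e > 0"
  shows "\<exists>n. (p, q) \<in> jump T e ^^ Suc n"
proof (rule ccontr)
  assume no: "\<nexists>n. (p, q) \<in> jump T e ^^ Suc n"
  define U where "U = {y. \<exists>n. (p, y) \<in> jump T e ^^ Suc n}"
  have "q \<notin> U" using no by (simp add: U_def)
  have near: "y \<in> U" if "z \<in> U" "dist (T z) y < e" for y z
    using that chain_Suc_iff unfolding U_def by blast
  have "T p \<in> U" unfolding U_def using e by (auto simp: jump_def intro: exI[of _ 0])
  have TU: "T y \<in> U" if "y \<in> U" for y using near[OF that, of "T y"] e by simp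
  define h where "h y = min 1 (infdist y (T ` U) / e)" for y
  have ne: "T ` U \<noteq> {}" using \<open>T p \<in> U\<close> by blast
  have h01: "0 \<le> h y" "h y \<le> 1" for y
    using e infdist_nonneg[of y] by (auto simp: h_def)
  have h0: "h (T y) = 0" if "y \<in> U" for y
    using that by (simp add: h_def)
  have h1: "h y = 1" if "y \<notin> U" for y
  proof -
    have "e \<le> dist y z" if "z \<in> T ` U" for z
      using near \<open>y \<notin> U\<close> that by (metis dist_commute imageE not_le)
    then have "e \<le> infdist y (T ` U)"
      unfolding infdist_notempty[OF ne] by (intro cINF_greatest[OF ne])
    then show ?thesis using e by (simp add: h_def)
  qed
  have cont_h: "continuous_on UNIV h"
    unfolding h_def using e by (intro continuous_intros) auto
  have cont_it: "continuous_on UNIV (T ^^ n)" for n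
    by (induction n) (auto intro: continuous_on_compose2[OF T] simp: o_def id_def)
  define c where "c y n = (1/2) ^ Suc n * h ((T ^^ n) y)" for y n
  have c_le: "norm (c y n) \<le> (1/2) ^ Suc n" for y n
    unfolding c_def using h01[of "(T ^^ n) y"] by (simp add: abs_mult mult_left_le)
  have sm: "summable (\<lambda>n. (1/2) ^ Suc n :: real)"
    by (simp only: summable_Suc_iff) (rule summable_geometric, simp)
  have smc: "summable (c y)" for y
    by (rule summable_comparison_test'[OF sm, of 0]) (rule c_le)
  define \<pi> where "\<pi> y = (\<Sum>n. c y n)" for y
  have cont_pi: "continuous_on UNIV \<pi>"
  proof (rule uniform_limit_theorem)
    show "uniform_limit UNIV (\<lambda>n y. \<Sum>i<n. c y i) \<pi> sequentially"
      unfolding \<pi>_def by (rule Weierstrass_m_test[OF c_le sm])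
    show "\<forall>\<^sub>F n in sequentially. continuous_on UNIV (\<lambda>y. \<Sum>i<n. c y i)"
      unfolding c_def
      by (intro always_eventually allI continuous_intros continuous_on_compose2[OF cont_h cont_it]) auto
  qed simp
  have rec: "\<pi> y = h y / 2 + \<pi> (T y) / 2" for y
  proof -
    have "(\<lambda>n. c y (Suc n)) = (\<lambda>n. c (T y) n / 2)" by (auto simp: c_def funpow_swap1)
    then have "(\<Sum>n. c y (Suc n)) = \<pi> (T y) / 2"
      unfolding \<pi>_def by (simp only: suminf_divide[OF smc])
    then show ?thesis
      using suminf_split_head[OF smc[of y]] unfolding \<pi>_def by (simp add: c_def)
  qed
  have pi0: "\<pi> (T y) = 0" if "y \<in> U" for y
  proof -
    have "(T ^^ n) y \<in> U" for n by (induction n) (auto simp: that TU)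
    then have "c (T y) n = 0" for n by (simp add: c_def h0 flip: funpow_swap1)
    then show ?thesis by (simp add: \<pi>_def)
  qed
  have pi_nonneg: "0 \<le> \<pi> y" for y
    unfolding \<pi>_def by (rule suminf_nonneg[OF smc]) (simp add: c_def h01)
  define S :: "real \<Rightarrow> real" where "S v = max 0 (2 * v - 1)" for v
  have semi: "\<pi> (T y) = S (\<pi> y)" for y
  proof (cases "y \<in> U")
    case True
    then show ?thesis using rec[of y] pi0[OF True] h01[of y] by (simp add: S_def)
  next
    case False
    then show ?thesis using rec[of y] h1[OF False] pi_nonneg[of "T y"] by (simp add: S_def)
  qed
  define Y where "Y = range \<pi>"
  have cY: "compact Y" unfolding Y_def by (rule compact_continuous_image[OF cont_pi X])
  have SY: "S ` Y \<subseteq> Y" unfolding Y_def using semi by (auto simp flip: semi)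
  have "0 < top_entropy (top_of_set Y) S"
  proof (rule cpe_imp_factor_entropy_pos[OF cpe])
    have "continuous_on Y S" unfolding S_def by (intro continuous_intros)
    then show "tds (top_of_set Y) S"
      unfolding tds_def using cY SY
      by (auto simp: compact_space_subtopology metrizable_space_subtopology metrizable_space_euclidean)
    show "factor_of (top_of_set Y) S euclidean T"
      unfolding factor_of_def using cont_pi semi
      by (intro exI[of _ \<pi>]) (auto simp: Y_def continuous_map_in_subtopology)
    show "\<nexists>v. topspace (top_of_set Y) = {v}"
    proof
      assume "\<exists>v. topspace (top_of_set Y) = {v}"
      then obtain v where "range \<pi> = {v}" by (auto simp: Y_def)
      then have "\<pi> q = \<pi> (T (T p))" by (metis rangeI singletonD)
      moreover have "\<pi> (T (T p)) = 0" by (rule pi0[OF \<open>T p \<in> U\<close>])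
      moreover have "\<pi> q \<ge> 1 / 2" using rec[of q] h1[OF \<open>q \<notin> U\<close>] pi_nonneg[of "T q"] by simp
      ultimately show False by simp
    qed
  qed
  moreover have "top_entropy (top_of_set Y) S \<le> 0"
    by (rule top_entropy_mono_on[OF cY _ SY]) (auto simp: S_def intro: mono_onI)
  ultimately show False by simp
qed


text \<open>
  Reachability from \<open>p\<close> by chains of the same length is an equivalence relation \<open>R\<close> on the space,
  invariant under \<open>T\<close> and with open classes. By compactness the quotient is a finite factor, and a
  finite system has zero entropy; so there is only one class. This is where periodic behaviour of
  chain transitive maps is excluded.
\<close>
lemma cpe_chain_synchronized:
  fixes T :: "'a::metric_space \<Rightarrow> 'a"
  assumes X: "compact (UNIV :: 'a set)" and T: "continuous_on UNIV T"
    and cpe: "cpe euclidean T" and e: "e > 0"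
  shows "\<exists>n. (p, p) \<in> jump T e ^^ Suc n \<and> (p, q) \<in> jump T e ^^ Suc n"
proof -
  note ct = cpe_chain_transitive[OF X T cpe e]
  define R where "R x y \<longleftrightarrow> (\<exists>n. (p, x) \<in> jump T e ^^ Suc n \<and> (p, y) \<in> jump T e ^^ Suc n)" for x y
  have refl: "R x x" for x using ct[of p x] by (auto simp: R_def)
  have sym: "R x y \<Longrightarrow> R y x" for x y by (auto simp: R_def)
  have trans: "R x z" if xy: "R x y" and yz: "R y z" for x y z
  proof -
    obtain a where a: "(p, x) \<in> jump T e ^^ Suc a" "(p, y) \<in> jump T e ^^ Suc a"
      using xy by (auto simp only: R_def)
    obtain b where b: "(p, y) \<in> jump T e ^^ Suc b" "(p, z) \<in> jump T e ^^ Suc b"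
      using yz by (auto simp only: R_def)
    obtain c where c: "(y, p) \<in> jump T e ^^ Suc c" using ct by blast
    \<comment> \<open>Going once around a loop at \<open>p\<close> through \<open>y\<close> before heading for \<open>x\<close> or \<open>z\<close>
      makes both lengths equal.\<close>
    have "(p, x) \<in> jump T e ^^ (Suc b + Suc c + Suc a)"
      by (intro chain_trans[OF chain_trans[OF b(1) c] a(1)])
    moreover have "(p, z) \<in> jump T e ^^ (Suc a + Suc c + Suc b)"
      by (intro chain_trans[OF chain_trans[OF a(2) c] b(2)])
    moreover have "Suc b + Suc c + Suc a = Suc (a + b + c + 2)" "Suc a + Suc c + Suc b = Suc (a + b + c + 2)"
      by simp_all
    ultimately show ?thesis unfolding R_def by (metis (lifting))
  qed
  have RT: "R (T x) (T y)" if "R x y" for x y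
    using that chain_step[OF e] unfolding R_def by blast
  have open_R: "open {y. R x y}" for x
  proof -
    have "{y. R x y} = (\<Union>n\<in>{n. (p, x) \<in> jump T e ^^ Suc n}. {y. (p, y) \<in> jump T e ^^ Suc n})"
      unfolding R_def by blast
    then show ?thesis by (simp only:) (intro open_UN ballI open_chain_reach)
  qed
  \<comment> \<open>The quotient is realised by a choice of representatives, with the discrete topology.\<close>
  define \<rho> where "\<rho> x = (SOME y. R x y)" for x
  have rho: "R x (\<rho> x)" for x unfolding \<rho>_def by (rule someI[of "R x" x, OF refl])
  have rho_eq: "\<rho> x = \<rho> y" if "R x y" for x y
  proof -
    have "R x z \<longleftrightarrow> R y z" for z using that sym trans by blast
    then show ?thesis by (simp add: \<rho>_def)
  qed
  have cont: "continuous_map euclidean (discrete_topology (range \<rho>)) \<rho>"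
    unfolding continuous_map_def
  proof (intro conjI allI impI)
    fix V
    have "{x \<in> topspace euclidean. \<rho> x \<in> V} = (\<Union>x\<in>\<rho> -` V. {y. R x y})"
      using refl rho_eq by auto
    then show "openin euclidean {x \<in> topspace euclidean. \<rho> x \<in> V}"
      using open_R by auto
  qed auto
  have fin: "finite (range \<rho>)"
    using image_compactin[OF _ cont, of UNIV] X by (simp add: compactin_discrete_topology)
  define S where "S y = \<rho> (T y)" for y
  have S: "S ` range \<rho> \<subseteq> range \<rho>" by (auto simp: S_def)
  have "\<exists>y. range \<rho> = {y}"
  proof (rule ccontr)
    assume nt: "\<nexists>y. range \<rho> = {y}"
    have "tds (discrete_topology (range \<rho>)) S"
      using fin S by (auto simp: tds_def compact_space_discrete_topology)
    moreover have "factor_of (discrete_topology (range \<rho>)) S euclidean T"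
      unfolding factor_of_def using cont rho_eq RT rho
      by (intro exI[of _ \<rho>]) (auto simp: S_def)
    ultimately have "0 < top_entropy (discrete_topology (range \<rho>)) S"
      using cpe nt unfolding cpe_def by auto
    moreover have "top_entropy (discrete_topology (range \<rho>)) S \<le> 0"
      by (rule top_entropy_finite) (use fin S in auto)
    ultimately show False by simp
  qed
  then have "\<rho> p = \<rho> q" by (metis rangeI singletonD)
  then have "R p q" using rho sym trans by metis
  then show ?thesis by (simp only: R_def)
qed

section \<open>Entropy of factors of systems with shadowing\<close>

lemma chain_concat_fun:
  fixes R :: "'a rel"
  assumes "(x, y) \<in> R ^^ m" "(y, z) \<in> R ^^ n"
  obtains c where "c 0 = x" "c m = y" "c (m + n) = z" "\<And>i. i < m + n \<Longrightarrow> (c i, c (Suc i)) \<in> R"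
proof -
  obtain f where f: "f 0 = x" "f m = y" "\<And>i. i < m \<Longrightarrow> (f i, f (Suc i)) \<in> R"
    using assms(1) unfolding relpow_fun_conv by blast
  obtain g where g: "g 0 = y" "g n = z" "\<And>i. i < n \<Longrightarrow> (g i, g (Suc i)) \<in> R"
    using assms(2) unfolding relpow_fun_conv by blast
  define c where "c i = (if i < m then f i else g (i - m))" for i
  have "(c i, c (Suc i)) \<in> R" if "i < m + n" for i
  proof (cases "i < m")
    case True
    then have "c (Suc i) = f (Suc i)"
      using f(2) g(1) by (cases "Suc i < m") (auto simp: c_def not_less dest: le_antisym)
    then show ?thesis using True f(3) by (simp add: c_def)
  next
    case False
    then show ?thesis using that g(3)[of "i - m"] by (simp add: c_def Suc_diff_le)
  qed
  moreover have "c 0 = x" using f g by (cases "m = 0") (auto simp: c_def)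
  ultimately show ?thesis using that[of c] g by (simp add: c_def)
qed

text \<open>
  Two loops \<open>c False\<close> and \<open>c True\<close> at \<open>p\<close> of the same length \<open>N\<close> can be concatenated in any order
  into a pseudo orbit; shadowing it gives a point whose orbit follows a prescribed code \<open>s\<close>.
\<close>
lemma shadowing_coding:
  assumes loop: "\<And>b. c b 0 = (p::'a::metric_space)" "\<And>b. c b N = p"
      "\<And>b i. i < N \<Longrightarrow> (c b i, c b (Suc i)) \<in> jump T d"
    and "N > 0"
    and shad: "\<And>x. pseudo_orbit T d x \<Longrightarrow> \<exists>y. \<forall>n. dist (x n) ((T ^^ n) y) \<le> e"
  shows "\<exists>y. \<forall>k. \<forall>i<N. dist (c (s k) i) ((T ^^ (k * N + i)) y) \<le> e"
proof -
  define x where "x n = c (s (n div N)) (n mod N)" for n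
  have "pseudo_orbit T d x"
    unfolding pseudo_orbit_def
  proof
    fix n
    have l: "n mod N < N" using \<open>N > 0\<close> by simp
    have "x (Suc n) = c (s (n div N)) (Suc (n mod N))"
    proof (cases "Suc (n mod N) = N")
      case True
      then have "Suc n mod N = 0" by (simp add: mod_Suc)
      then show ?thesis using True loop(1,2) by (simp add: x_def)
    next
      case False
      then show ?thesis by (simp add: x_def mod_Suc div_Suc)
    qed
    then show "dist (T (x n)) (x (Suc n)) \<le> d"
      using loop(3)[OF l, of "s (n div N)"] by (simp add: x_def jump_def)
  qed
  from shad[OF this] obtain y where y: "\<And>n. dist (x n) ((T ^^ n) y) \<le> e" by blast
  have "x (k * N + i) = c (s k) i" if "i < N" for k i
    using that by (simp add: x_def)
  then show ?thesis using y by metis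
qed

text \<open>
  A factor map that separates \<open>F\<close> from \<open>G\<close> sends the \<open>2 ^ k\<close> codes of length \<open>k\<close> to points that no
  member of the join over \<open>k * N\<close> steps can share: such a member avoids the image of \<open>F\<close> or of \<open>G\<close> at
  each time \<open>j * N + m\<close>.
\<close>
lemma factor_entropy_pos:
  fixes T :: "'a::metric_space \<Rightarrow> 'a"
  assumes X: "compact (UNIV :: 'a set)" and Y: "tds Y S" 
    and \<phi>: "continuous_map euclidean Y \<phi>" "range \<phi> = topspace Y" "\<And>x. \<phi> (T x) = S (\<phi> x)"
    and F: "closed F" "closed G" "\<phi> ` F \<inter> \<phi> ` G = {}" and "m < N"
    and code: "\<And>s :: nat \<Rightarrow> bool. \<exists>y. \<forall>k. (T ^^ (k * N + m)) y \<in> (if s k then G else F)"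
  shows "0 < top_entropy Y S"
proof -
  define C where "C = {topspace Y - \<phi> ` F, topspace Y - \<phi> ` G}"
  have cY: "compact_space Y" and H: "Hausdorff_space Y" and SY: "S ` topspace Y \<subseteq> topspace Y"
    using Y by (auto simp: tds_def metrizable_imp_Hausdorff_space continuous_map_def)
  have cl: "closedin Y (\<phi> ` A)" if "closed A" for A
  proof (rule compactin_imp_closedin[OF H])
    have "compact A" using compact_Int_closed[OF X that] by simp
    then show "compactin Y (\<phi> ` A)" using image_compactin[OF _ \<phi>(1)] by simp
  qed
  have C: "open_cover Y C"
    unfolding open_cover_def C_def using cl F by (auto simp: openin_diff)
  have it: "\<phi> ((T ^^ i) x) = (S ^^ i) (\<phi> x)" for i x
    by (induction i) (auto simp: \<phi>(3))
  from code obtain z where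
    z: "\<And>s k. (T ^^ (k * N + m)) (z s) \<in> (if s k then G else F)" by metis
  show ?thesis
  proof (rule top_entropy_posI[OF SY cY C])
    show "topspace Y \<noteq> {}" using \<phi>(2) by auto
    show "0 < N" using \<open>m < N\<close> by simp
    fix k E assume E: "E \<subseteq> cover_join Y S C (k * N)" "finite E" "topspace Y \<subseteq> \<Union>E"
    \<comment> \<open>Codes of length \<open>k\<close> are written as subsets of \<open>{..<k}\<close>.\<close>
    define v where "v A = \<phi> (z (\<lambda>j. j \<in> A))" for A
    have "\<forall>A. \<exists>W\<in>E. v A \<in> W" using E(3) \<phi>(2) unfolding v_def by blast
    then obtain W where W: "\<And>A. W A \<in> E" "\<And>A. v A \<in> W A" by metis
    have sep: False if "W A = W B" "j \<in> A" "j \<notin> B" "j < k" for A B j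
    proof -
      obtain U where U: "\<forall>i<k * N. U i \<in> C" "W A = {y \<in> topspace Y. \<forall>i<k * N. (S ^^ i) y \<in> U i}"
        using W(1)[of A] E(1) by (auto simp: cover_join_def)
      have "j * N + m < Suc j * N" using \<open>m < N\<close> by simp
      also have "\<dots> \<le> k * N" using \<open>j < k\<close> by (intro mult_right_mono) auto
      finally have i: "j * N + m < k * N" .
      have "v A \<in> W A" "v B \<in> W A" using W(2) that(1) by metis+
      then have "(S ^^ (j * N + m)) (v A) \<in> U (j * N + m)" "(S ^^ (j * N + m)) (v B) \<in> U (j * N + m)"
        using i by (simp_all only: U(2)) blast+
      moreover have "(S ^^ (j * N + m)) (v A) \<in> \<phi> ` G"
        using z[of j "\<lambda>j. j \<in> A"] that by (simp add: v_def flip: it)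
      moreover have "(S ^^ (j * N + m)) (v B) \<in> \<phi> ` F"
        using z[of j "\<lambda>j. j \<in> B"] that by (simp add: v_def flip: it)
      ultimately show False using U(1) i unfolding C_def by blast
    qed
    have "inj_on W (Pow {..<k})"
    proof (rule inj_onI)
      fix A B assume A: "A \<in> Pow {..<k}" "B \<in> Pow {..<k}" "W A = W B"
      show "A = B"
      proof (rule ccontr)
        assume "A \<noteq> B"
        then obtain j where "j \<in> A \<and> j \<notin> B \<or> j \<in> B \<and> j \<notin> A" by blast
        then show False using sep[of A B j] sep[of B A j] A by auto
      qed
    qed
    then have "card (Pow {..<k}) \<le> card E"
      using W(1) E(2) by (intro card_inj_on_le) auto
    then show "2 ^ k \<le> card E" by (simp add: card_Pow)
  qed
qed

text \<open>
  Given a nontrivial factor, choose \<open>p\<close> and \<open>q\<close> in \<open>D\<close> with distinct images. Chains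
  \<open>p \<rightarrow> p\<close> and \<open>p \<rightarrow> q\<close> of a common length, and a chain \<open>q \<rightarrow> p\<close>, can be arranged into two loops
  of equal length at \<open>p\<close>, namely \<open>p \<rightarrow> p \<rightarrow> q \<rightarrow> p\<close> and \<open>p \<rightarrow> q \<rightarrow> p \<rightarrow> p\<close>. At
  the end of the first leg they are at \<open>p\<close> and at \<open>q\<close>, which gives the horseshoe that the factor
  sees.
\<close>
lemma shadowing_synchronized_imp_cpe:
  fixes T :: "'a::metric_space \<Rightarrow> 'a"
  assumes X: "compact (UNIV :: 'a set)" and shad: "shadowing T"
    and D: "closure D = UNIV"
    and sync: "\<And>p q e. p \<in> D \<Longrightarrow> q \<in> D \<Longrightarrow> e > 0 \<Longrightarrow>
      \<exists>n. (p, p) \<in> jump T e ^^ Suc n \<and> (p, q) \<in> jump T e ^^ Suc n"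
  shows "cpe euclidean T"
  unfolding cpe_def
proof (intro allI impI, elim conjE)
  fix Y :: "'a topology" and S
  assume Y: "tds Y S" and fac: "factor_of Y S euclidean T" and nt: "\<nexists>p. topspace Y = {p}"
  obtain \<phi> where \<phi>: "continuous_map euclidean Y \<phi>" "range \<phi> = topspace Y" "\<And>x. \<phi> (T x) = S (\<phi> x)"
    using fac by (auto simp: factor_of_def)
  have H: "Hausdorff_space Y" using Y by (auto simp: tds_def metrizable_imp_Hausdorff_space)
  obtain a b where "\<phi> a \<noteq> \<phi> b"
    using nt \<phi>(2) by (metis (no_types, lifting) image_constant_conv UNIV_not_empty image_cong)
  then obtain V W where VW: "openin Y V" "openin Y W" "\<phi> a \<in> V" "\<phi> b \<in> W" "disjnt V W"
    using H \<phi>(2) unfolding Hausdorff_space_def by (metis rangeI)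
  have opV: "open (\<phi> -` V)" "open (\<phi> -` W)"
    using openin_continuous_map_preimage[OF \<phi>(1) VW(1)] openin_continuous_map_preimage[OF \<phi>(1) VW(2)]
    by (simp_all add: vimage_def)
  have "D \<inter> \<phi> -` V \<noteq> {}" "D \<inter> \<phi> -` W \<noteq> {}"
    using open_Int_closure_eq_empty[OF opV(1), of D] open_Int_closure_eq_empty[OF opV(2), of D] D VW(3,4)
    by auto
  then obtain p q where pq: "p \<in> D" "q \<in> D" "p \<in> \<phi> -` V" "q \<in> \<phi> -` W" by blast
  obtain e1 where e1: "e1 > 0" "cball p e1 \<subseteq> \<phi> -` V" using opV(1) pq(3) open_contains_cball by metis
  obtain e2 where e2: "e2 > 0" "cball q e2 \<subseteq> \<phi> -` W" using opV(2) pq(4) open_contains_cball by metis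
  define e where "e = min e1 e2"
  have e: "e > 0" "cball p e \<subseteq> \<phi> -` V" "cball q e \<subseteq> \<phi> -` W"
    using e1 e2 by (auto simp: e_def)
  obtain d where d: "d > 0"
    "\<And>x. pseudo_orbit T d x \<Longrightarrow> \<exists>y. \<forall>n. dist (x n) ((T ^^ n) y) \<le> e"
    using shad e(1) unfolding shadowing_def by metis
  obtain n where n: "(p, p) \<in> jump T d ^^ Suc n" "(p, q) \<in> jump T d ^^ Suc n"
    using sync[OF pq(1,2) d(1)] by blast
  obtain m where m: "(q, p) \<in> jump T d ^^ Suc m" "(q, q) \<in> jump T d ^^ Suc m"
    using sync[OF pq(2,1) d(1)] by blast
  obtain f where f: "f 0 = p" "f (Suc n) = p" "f (Suc n + (Suc n + Suc m)) = p"
    "\<And>i. i < Suc n + (Suc n + Suc m) \<Longrightarrow> (f i, f (Suc i)) \<in> jump T d"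
    using chain_concat_fun[OF n(1) chain_trans[OF n(2) m(1)]] by metis
  obtain g where g: "g 0 = p" "g (Suc n) = q" "g (Suc n + (Suc m + Suc n)) = p"
    "\<And>i. i < Suc n + (Suc m + Suc n) \<Longrightarrow> (g i, g (Suc i)) \<in> jump T d"
    using chain_concat_fun[OF n(2) chain_trans[OF m(1) n(1)]] by metis
  define N where "N = Suc n + (Suc n + Suc m)"
  have N: "N = Suc n + (Suc m + Suc n)" "Suc n < N" "0 < N" by (simp_all add: N_def)
  define c where "c b = (if b then g else f)" for b
  have c: "c b 0 = p" "c b N = p" "i < N \<Longrightarrow> (c b i, c b (Suc i)) \<in> jump T d" for b i
    using f g unfolding c_def by (simp_all add: N_def ac_simps)
  show "0 < top_entropy Y S"
  proof (rule factor_entropy_pos[OF X Y \<phi> _ _ _ N(2)])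
    show "\<phi> ` cball p e \<inter> \<phi> ` cball q e = {}"
      using e VW(5) by (fastforce simp: disjnt_def)
    fix s :: "nat \<Rightarrow> bool"
    obtain y where y: "\<forall>k. \<forall>i<N. dist (c (s k) i) ((T ^^ (k * N + i)) y) \<le> e"
      using shadowing_coding[of c p N T d e s, OF c N(3) d(2)] by blast
    have "(T ^^ (k * N + Suc n)) y \<in> (if s k then cball q e else cball p e)" for k
      using y[rule_format, OF N(2), of k] f(2) g(2) by (auto simp: c_def)
    then show "\<exists>y. \<forall>k. (T ^^ (k * N + Suc n)) y \<in> (if s k then cball q e else cball p e)"
      by blast
  qed auto
qed

section \<open>Borel complexity\<close>

text \<open>
  Shadowing only has to be tested on finite pseudo orbits in a dense set. From finite to infinite, a
  limit of points that shadow longer and longer initial segments shadows the whole pseudo orbit;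
  moving a pseudo orbit into \<open>D\<close> costs a bit of precision, by uniform continuity.
\<close>
lemma shadowing_iff_finite:
  fixes T :: "'a::metric_space \<Rightarrow> 'a"
  assumes X: "compact (UNIV :: 'a set)" and T: "continuous_on UNIV T" and D: "closure D = UNIV"
  shows "shadowing T \<longleftrightarrow> (\<forall>k. \<exists>m. \<forall>xs\<in>lists D.
    (\<forall>i. Suc i < length xs \<longrightarrow> (xs ! i, xs ! Suc i) \<in> jump T (inverse (real (Suc m)))) \<longrightarrow>
    (\<exists>y. \<forall>i<length xs. dist (xs ! i) ((T ^^ i) y) < inverse (real (Suc k))))"
    (is "_ \<longleftrightarrow> ?fin")
proof
  assume shad: "shadowing T"
  show ?fin
  proof
    fix k
    define e where "e = inverse (real (Suc k))"
    have "e > 0" by (simp add: e_def)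
    then obtain d where d: "d > 0"
      "\<And>x. pseudo_orbit T d x \<Longrightarrow> \<exists>y. \<forall>n. dist (x n) ((T ^^ n) y) \<le> e / 2"
      using shad unfolding shadowing_def by (metis half_gt_zero)
    obtain m where m: "inverse (real (Suc m)) < d" using reals_Archimedean[OF d(1)] by blast
    have "\<exists>y. \<forall>i<length xs. dist (xs ! i) ((T ^^ i) y) < e"
      if j: "\<And>i. Suc i < length xs \<Longrightarrow> (xs ! i, xs ! Suc i) \<in> jump T (inverse (real (Suc m)))"
      for xs
    proof -
      \<comment> \<open>Continue the finite pseudo orbit by the true orbit of its last point.\<close>
      define x where "x n = (if n < length xs then xs ! n else (T ^^ (Suc n - length xs)) (last xs))" for n
      have "dist (T (x n)) (x (Suc n)) \<le> d" for n
      proof -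
        consider "Suc n < length xs" | "Suc n = length xs" | "length xs \<le> n" by linarith
        then show ?thesis
        proof cases
          case 1
          then show ?thesis using j[of n] m by (simp add: x_def jump_def)
        next
          case 2
          then have "xs ! n = last xs" by (metis diff_Suc_1 last_conv_nth list.size(3) nat.simps(3))
          then show ?thesis using 2 d(1) by (simp add: x_def flip: 2)
        next
          case 3
          then show ?thesis using d(1) by (simp add: x_def Suc_diff_le)
        qed
      qed
      then have "pseudo_orbit T d x" by (simp add: pseudo_orbit_def)
      then obtain y where y: "\<And>n. dist (x n) ((T ^^ n) y) \<le> e / 2" using d(2) by blast
      have "dist (xs ! i) ((T ^^ i) y) < e" if "i < length xs" for i
        using y[of i] that \<open>e > 0\<close> by (simp add: x_def)
      then show ?thesis by blast
    qed
    then show "\<exists>m. \<forall>xs\<in>lists D.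
      (\<forall>i. Suc i < length xs \<longrightarrow> (xs ! i, xs ! Suc i) \<in> jump T (inverse (real (Suc m)))) \<longrightarrow>
      (\<exists>y. \<forall>i<length xs. dist (xs ! i) ((T ^^ i) y) < inverse (real (Suc k)))"
      unfolding e_def by (intro exI[of _ m]) blast
  qed
next
  assume fin: ?fin
  show "shadowing T"
    unfolding shadowing_def
  proof (intro allI impI)
    fix e :: real assume e: "e > 0"
    then obtain k where k: "inverse (real (Suc k)) < e / 2" using reals_Archimedean half_gt_zero by metis
    obtain m where m: "\<And>xs. xs \<in> lists D \<Longrightarrow>
        (\<forall>i. Suc i < length xs \<longrightarrow> (xs ! i, xs ! Suc i) \<in> jump T (inverse (real (Suc m)))) \<Longrightarrow>
        (\<exists>y. \<forall>i<length xs. dist (xs ! i) ((T ^^ i) y) < inverse (real (Suc k)))"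
      using fin by metis
    define r where "r = inverse (real (Suc m))"
    have r: "r > 0" by (simp add: r_def)
    have "uniformly_continuous_on UNIV T" by (rule compact_uniformly_continuous[OF T X])
    then obtain t where t: "t > 0" "\<And>a b. dist a b < t \<Longrightarrow> dist (T a) (T b) < r / 3"
      using r unfolding uniformly_continuous_on_def by (metis UNIV_I zero_less_divide_iff zero_less_numeral)
    show "\<exists>d>0. \<forall>x. pseudo_orbit T d x \<longrightarrow> (\<exists>y. \<forall>n. dist (x n) ((T ^^ n) y) \<le> e)"
    proof (intro exI[of _ "r / 3"] conjI allI impI)
      show "r / 3 > 0" using r by simp
      fix x assume x: "pseudo_orbit T (r / 3) x"
      \<comment> \<open>One third of \<open>r\<close> each for the displacement of \<open>T (x n)\<close>, the jump of \<open>x\<close>, and the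
        displacement of \<open>x (Suc n)\<close>.\<close>
      define u where "u = min t (min (r / 3) (e / 2))"
      have u: "u > 0" "u \<le> t" "u \<le> r / 3" "u \<le> e / 2" using t(1) r e by (auto simp: u_def)
      have "\<forall>n. \<exists>z\<in>D. dist z (x n) < u"
        using u(1) D closure_approachable by blast
      then obtain z where z: "\<And>n. z n \<in> D" "\<And>n. dist (z n) (x n) < u" by metis
      have jump_z: "(z n, z (Suc n)) \<in> jump T r" for n
      proof -
        have "dist (T (z n)) (z (Suc n)) \<le> dist (T (z n)) (T (x n)) + dist (T (x n)) (x (Suc n))
          + dist (x (Suc n)) (z (Suc n))"
          using dist_triangle[of "T (z n)" "z (Suc n)" "T (x n)"]
            dist_triangle[of "T (x n)" "z (Suc n)" "x (Suc n)"] by linarith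
        moreover have "dist (T (z n)) (T (x n)) < r / 3" using t(2) z(2)[of n] u(2) by force
        moreover have "dist (T (x n)) (x (Suc n)) \<le> r / 3" using x by (simp add: pseudo_orbit_def)
        moreover have "dist (x (Suc n)) (z (Suc n)) < r / 3"
          using z(2)[of "Suc n"] u(3) by (simp add: dist_commute)
        ultimately show ?thesis by (simp add: jump_def)
      qed
      have "\<exists>y. \<forall>i<n. dist (z i) ((T ^^ i) y) < inverse (real (Suc k))" for n
      proof -
        have "map z [0..<n] \<in> lists D" using z(1) by (auto simp: in_lists_conv_set)
        from m[OF this] show ?thesis using jump_z by (simp add: r_def)
      qed
      then obtain y where y: "\<And>n i. i < n \<Longrightarrow> dist (z i) ((T ^^ i) (y n)) < inverse (real (Suc k))"
        by metis
      have xy: "dist (x i) ((T ^^ i) (y n)) \<le> e" if "i < n" for i n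
        using y[OF that] z(2)[of i] u(4) k dist_triangle[of "x i" "(T ^^ i) (y n)" "z i"]
        by (simp add: dist_commute)
      obtain l s where s: "strict_mono s" "(y \<circ> s) \<longlonglongrightarrow> l"
        using compact_imp_seq_compact[OF X] unfolding seq_compact_def by (metis UNIV_I)
      have cont_it: "continuous_on UNIV (T ^^ i)" for i
        by (induction i) (auto intro: continuous_on_compose2[OF T] simp: o_def id_def)
      have "dist (x i) ((T ^^ i) l) \<le> e" for i
      proof (rule LIMSEQ_le_const2)
        have "(\<lambda>n. (T ^^ i) (y (s n))) \<longlonglongrightarrow> (T ^^ i) l"
          using continuous_on_tendsto_compose[OF cont_it s(2), of i] by (simp add: o_def)
        then show "(\<lambda>n. dist (x i) ((T ^^ i) (y (s n)))) \<longlonglongrightarrow> dist (x i) ((T ^^ i) l)"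
          by (intro tendsto_intros)
        show "\<exists>N. \<forall>n\<ge>N. dist (x i) ((T ^^ i) (y (s n))) \<le> e"
          using xy seq_suble[OF s(1)] by (intro exI[of _ "Suc i"]) (meson Suc_le_lessD le_trans)
      qed
      then show "\<exists>y. \<forall>n. dist (x n) ((T ^^ n) y) \<le> e" by blast
    qed
  qed
qed

lemma continuous_on_bcontfun_eval:
  fixes g :: "('a::metric_space \<Rightarrow>\<^sub>C 'b::metric_space) \<Rightarrow> 'a"
  assumes g: "continuous_on UNIV g"
  shows "continuous_on UNIV (\<lambda>T. apply_bcontfun T (g T))"
  unfolding continuous_on_iff
proof (intro ballI allI impI)
  fix T :: "'a \<Rightarrow>\<^sub>C 'b" and e :: real assume "e > 0"
  have "continuous_on UNIV (\<lambda>T'. apply_bcontfun T (g T'))"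
    by (rule continuous_on_compose2[OF continuous_on_apply_bcontfun g]) auto
  then obtain d where d: "d > 0"
      "\<And>T'. dist T' T < d \<Longrightarrow> dist (apply_bcontfun T (g T')) (apply_bcontfun T (g T)) < e / 2"
    using \<open>e > 0\<close> unfolding continuous_on_iff by (metis UNIV_I half_gt_zero)
  show "\<exists>d>0. \<forall>T'\<in>UNIV. dist T' T < d \<longrightarrow>
      dist (apply_bcontfun T' (g T')) (apply_bcontfun T (g T)) < e"
  proof (intro exI[of _ "min d (e / 2)"] conjI ballI impI)
    fix T' assume T': "dist T' T < min d (e / 2)"
    have "dist (apply_bcontfun T' (g T')) (apply_bcontfun T (g T')) \<le> dist T' T"
      by (rule dist_bounded)
    then show "dist (apply_bcontfun T' (g T')) (apply_bcontfun T (g T)) < e"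
      using d(2)[of T'] T'
        dist_triangle[of "apply_bcontfun T' (g T')" "apply_bcontfun T (g T)" "apply_bcontfun T (g T')"]
      by simp
  qed (use d \<open>e > 0\<close> in simp)
qed

lemma continuous_on_funpow_bcontfun:
  fixes x :: "'a::metric_space"
  shows "continuous_on UNIV (\<lambda>T :: 'a \<Rightarrow>\<^sub>C 'a. (apply_bcontfun T ^^ i) x)"
  by (induction i) (simp_all add: continuous_on_bcontfun_eval)

lemma open_shadowed:
  fixes xs :: "'a::metric_space list"
  shows "open {T :: 'a \<Rightarrow>\<^sub>C 'a. \<exists>y. \<forall>i<length xs. dist (xs ! i) ((apply_bcontfun T ^^ i) y) < e}"
proof -
  have "{T :: 'a \<Rightarrow>\<^sub>C 'a. \<exists>y. \<forall>i<length xs. dist (xs ! i) ((apply_bcontfun T ^^ i) y) < e} =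
      (\<Union>y. \<Inter>i\<in>{..<length xs}. {T. dist (xs ! i) ((apply_bcontfun T ^^ i) y) < e})" by auto
  also have "open \<dots>"
    by (intro open_UN ballI open_INT finite_lessThan open_Collect_less continuous_intros
        continuous_on_funpow_bcontfun)
  finally show ?thesis .
qed

lemma open_jump:
  fixes x y :: "'a::metric_space"
  shows "open {T :: 'a \<Rightarrow>\<^sub>C 'a. (x, y) \<in> jump (apply_bcontfun T) e}"
  unfolding jump_def
  by simp (intro open_Collect_less continuous_intros continuous_on_bcontfun_eval)

lemma open_pseudo_orbit:
  fixes xs :: "'a::metric_space list"
  shows "open {T :: 'a \<Rightarrow>\<^sub>C 'a. \<forall>i. Suc i < length xs \<longrightarrow> (xs ! i, xs ! Suc i) \<in> jump (apply_bcontfun T) e}"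
proof -
  have "{T :: 'a \<Rightarrow>\<^sub>C 'a. \<forall>i. Suc i < length xs \<longrightarrow> (xs ! i, xs ! Suc i) \<in> jump (apply_bcontfun T) e} =
      (\<Inter>i\<in>{..<length xs - 1}. {T. (xs ! i, xs ! Suc i) \<in> jump (apply_bcontfun T) e})"
    by (auto simp: less_diff_conv)
  also have "open \<dots>" by (intro open_INT ballI open_jump) simp
  finally show ?thesis .
qed

lemma open_chain:
  fixes x y :: "'a::metric_space"
  shows "open {T :: 'a \<Rightarrow>\<^sub>C 'a. (x, y) \<in> jump (apply_bcontfun T) e ^^ n}"
proof -
  have "{T :: 'a \<Rightarrow>\<^sub>C 'a. (x, y) \<in> jump (apply_bcontfun T) e ^^ n} =
      (\<Union>f\<in>{f. f 0 = x \<and> f n = y}. \<Inter>i\<in>{..<n}. {T. (f i, f (Suc i)) \<in> jump (apply_bcontfun T) e})"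
    by (auto simp: relpow_fun_conv)
  also have "open \<dots>" by (intro open_UN open_INT ballI open_jump) simp
  finally show ?thesis .
qed

lemma compact_countable_dense:
  assumes "compact (UNIV :: 'a::metric_space set)"
  obtains D :: "'a::metric_space set" where "countable D" "closure D = UNIV"
proof -
  have "\<exists>F. finite F \<and> (UNIV :: 'a set) \<subseteq> (\<Union>x\<in>F. ball x (inverse (real (Suc n))))" for n
    using assms unfolding compact_eq_totally_bounded by simp
  then obtain F :: "nat \<Rightarrow> 'a set" where F: "\<And>n. finite (F n)"
    "\<And>n. UNIV \<subseteq> (\<Union>x\<in>F n. ball x (inverse (real (Suc n))))" by metis
  show ?thesis
  proof
    show "countable (\<Union>n. F n)" using F(1) by (auto intro: countable_finite)
    have "\<exists>z\<in>\<Union>n. F n. dist z x < e" if "e > 0" for x e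
    proof -
      obtain n where n: "inverse (real (Suc n)) < e" using reals_Archimedean[OF \<open>e > 0\<close>] by blast
      obtain z where "z \<in> F n" "dist z x < inverse (real (Suc n))" 
        using subsetD[OF F(2) UNIV_I] unfolding UN_iff mem_ball by blast
      with n show ?thesis by (intro bexI[of _ z]) auto
    qed
    then show "closure (\<Union>n. F n) = UNIV" using closure_approachable by blast
  qed
qed

lemma borel_Shad:
  fixes D :: "'a::metric_space set"
  assumes X: "compact (UNIV :: 'a set)" and D: "countable D" "closure D = UNIV"
  shows "(Shad :: ('a \<Rightarrow>\<^sub>C 'a) set) \<in> sets borel"
proof -
  have eq: "Shad = (\<Inter>k. \<Union>m. \<Inter>xs\<in>lists D.
      - {T :: 'a \<Rightarrow>\<^sub>C 'a. \<forall>i. Suc i < length xs \<longrightarrow>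
          (xs ! i, xs ! Suc i) \<in> jump (apply_bcontfun T) (inverse (real (Suc m)))} \<union>
      {T. \<exists>y. \<forall>i<length xs. dist (xs ! i) ((apply_bcontfun T ^^ i) y) < inverse (real (Suc k))})"
    unfolding Shad_def
      shadowing_iff_finite[OF X continuous_on_apply_bcontfun D(2)]
    by (rule set_eqI) (simp only: mem_Collect_eq INT_iff UN_iff Un_iff Compl_iff
        ball_UNIV bex_UNIV imp_conv_disj)
  show ?thesis
    unfolding eq
    by (intro sets.countable_INT'' sets.countable_UN'' sets.Un borel_comp borel_open
        open_pseudo_orbit open_shadowed countable_lists D) auto
qed

lemma borel_synchronized:
  fixes D :: "'a::metric_space set"
  assumes D: "countable D"
  shows "{T :: 'a \<Rightarrow>\<^sub>C 'a. \<forall>p\<in>D. \<forall>q\<in>D. \<forall>k. \<exists>n.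
     (p, p) \<in> jump (apply_bcontfun T) (inverse (real (Suc k))) ^^ Suc n \<and>
     (p, q) \<in> jump (apply_bcontfun T) (inverse (real (Suc k))) ^^ Suc n} \<in> sets borel" (is "?A \<in> _")
proof -
  have eq: "?A = (\<Inter>p\<in>D. \<Inter>q\<in>D. \<Inter>k. \<Union>n.
     {T. (p, p) \<in> jump (apply_bcontfun T) (inverse (real (Suc k))) ^^ Suc n} \<inter>
     {T. (p, q) \<in> jump (apply_bcontfun T) (inverse (real (Suc k))) ^^ Suc n})"
    by (rule set_eqI) (simp only: mem_Collect_eq INT_iff UN_iff Int_iff ball_UNIV bex_UNIV)
  show ?thesis
    unfolding eq
    by (intro sets.countable_INT'' sets.countable_UN'' sets.Int borel_open open_chain D) auto
qed

theorem corollary3p6: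
  assumes "compact (UNIV :: 'a::metric_space set)"
  shows "(Shad \<inter> CPE :: ('a \<Rightarrow>\<^sub>C 'a) set) \<in> sets borel"
proof -
  obtain D :: "'a set" where D: "countable D" "closure D = UNIV"
    using compact_countable_dense[OF assms] .
  define Sync where "Sync = {T :: 'a \<Rightarrow>\<^sub>C 'a. \<forall>p\<in>D. \<forall>q\<in>D. \<forall>k. \<exists>n.
     (p, p) \<in> jump (apply_bcontfun T) (inverse (real (Suc k))) ^^ Suc n \<and>
     (p, q) \<in> jump (apply_bcontfun T) (inverse (real (Suc k))) ^^ Suc n}"
  have "CPE \<subseteq> Sync"
  proof
    fix T :: "'a \<Rightarrow>\<^sub>C 'a" assume "T \<in> CPE"
    then have "cpe euclidean (apply_bcontfun T)" by (simp add: CPE_def)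
    from cpe_chain_synchronized[OF assms continuous_on_apply_bcontfun this]
    show "T \<in> Sync" by (simp add: Sync_def del: relpow.simps)
  qed
  moreover have "Shad \<inter> Sync \<subseteq> CPE"
  proof
    fix T :: "'a \<Rightarrow>\<^sub>C 'a" assume T: "T \<in> Shad \<inter> Sync"
    show "T \<in> CPE"
      unfolding CPE_def
    proof (intro CollectI shadowing_synchronized_imp_cpe[OF assms _ D(2)])
      show "shadowing (apply_bcontfun T)" using T by (simp add: Shad_def)
      fix p q and e :: real assume pq: "p \<in> D" "q \<in> D" and e: "e > 0"
      obtain k where k: "inverse (real (Suc k)) < e" using reals_Archimedean[OF e] by blast
      obtain n where "(p, p) \<in> jump (apply_bcontfun T) (inverse (real (Suc k))) ^^ Suc n"
        "(p, q) \<in> jump (apply_bcontfun T) (inverse (real (Suc k))) ^^ Suc n"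
        using T pq unfolding Sync_def by blast
      then show "\<exists>n. (p, p) \<in> jump (apply_bcontfun T) e ^^ Suc n \<and> (p, q) \<in> jump (apply_bcontfun T) e ^^ Suc n"
        using chain_mono[OF less_imp_le[OF k]] by blast
    qed
  qed
  ultimately have "Shad \<inter> CPE = Shad \<inter> Sync" by blast
  also have "\<dots> \<in> sets borel"
    unfolding Sync_def by (intro sets.Int borel_Shad[OF assms D] borel_synchronized[OF D(1)])
  finally show ?thesis .
qed

end
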